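(* Let $X=(S,A)$ be a simple undirected connected graph with an edge coloring $A\to\mathcal{C}$ ($\mathcal{C}$ a set of colors) such that: (1) the edges of any elementary cycle of $X$ all have the same color; (2) for each $c\in\mathcal{C}$, the connected components of the partial graph $X_c$ obtained by keeping only the edges of color $c$ are complete graphs. Suppose that each cell of $X$ has at most four vertices. Let $G$ be a finitely generated subgroup of $\mathrm{Isom}\,X$. If $G$ is a GAF, then $G$ is a GAG.
   Context: A cycle is elementary if no vertex occurs more than once in it except that the beginning and the end coincide. For $c\in\mathcal{C}$, a cell of color $c$ is any connected component of the partial graph $X_c$; a cell of $X$ is a cell of some color. The vertex set $S$ carries the graph distance (minimum number of edges of a path joining two vertices); $\mathrm{Isom}\,X$ is the group of bijections of $S$ preserving this distance (colors need not be preserved), acting on $S$. For a bijection $g$ of $S$, $\mathrm{Fix}\,g=\{x\in S: g(x)=x\}$. A group $G$ of bijections of $S$ is a GAF if $\mathrm{Fix}\,g\neq\emptyset$ for every $g\in G$; it is a GAG if $\bigcap_{g\in G}\mathrm{Fix}\,g\ne\emptyset$. *)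

theory Defs
  imports "HOL-Algebra.Algebra"
begin

section \<open>Simple undirected graphs, possibly infinite\<close>

text \<open>A graph is a vertex set \<open>S\<close> with a set \<open>A\<close> of edges, each an unordered pair of distinct
  vertices.\<close>

definition simple_graph :: "'a set \<Rightarrow> 'a set set \<Rightarrow> bool" where
  "simple_graph S A \<longleftrightarrow> (\<forall>e\<in>A. \<exists>u\<in>S. \<exists>v\<in>S. u \<noteq> v \<and> e = {u, v})"

text \<open>Paths are given by their lists of vertices and may repeat vertices; the list \<open>[x]\<close> is
  the path of length 0 at \<open>x\<close>.\<close>

definition path_between :: "'a set \<Rightarrow> 'a set set \<Rightarrow> 'a \<Rightarrow> 'a list \<Rightarrow> 'a \<Rightarrow> bool" where
  "path_between S A x p y \<longleftrightarrow>
     p \<noteq> [] \<and> hd p = x \<and> last p = y \<and> set p \<subseteq> S \<and> successively (\<lambda>u v. {u, v} \<in> A) p"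

definition path_edges :: "'a list \<Rightarrow> 'a set set" where
  "path_edges p = {{p ! i, p ! Suc i} | i. Suc i < length p}"

definition joined :: "'a set \<Rightarrow> 'a set set \<Rightarrow> 'a \<Rightarrow> 'a \<Rightarrow> bool" where
  "joined S A x y \<longleftrightarrow> (\<exists>p. path_between S A x p y)"

definition connected_graph :: "'a set \<Rightarrow> 'a set set \<Rightarrow> bool" where
  "connected_graph S A \<longleftrightarrow> (\<forall>x\<in>S. \<forall>y\<in>S. joined S A x y)"

definition graph_components :: "'a set \<Rightarrow> 'a set set \<Rightarrow> 'a set set" where
  "graph_components S A = {{y \<in> S. joined S A x y} | x. x \<in> S}"

text \<open>Only meaningful for vertices joined by a path.\<close>

definition graph_dist :: "'a set \<Rightarrow> 'a set set \<Rightarrow> 'a \<Rightarrow> 'a \<Rightarrow> nat" where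
  "graph_dist S A x y = (LEAST n. \<exists>p. path_between S A x p y \<and> length p = Suc n)"

text \<open>The first vertex is repeated at the end of the list. The length bound says that the cycle
  has at least three edges, which excludes running back and forth along one edge.\<close>

definition elementary_cycle :: "'a set \<Rightarrow> 'a set set \<Rightarrow> 'a list \<Rightarrow> bool" where
  "elementary_cycle S A p \<longleftrightarrow>
     length p \<ge> 4 \<and> path_between S A (hd p) p (hd p) \<and> distinct (tl p)"

definition complete_graph :: "'a set \<Rightarrow> 'a set set \<Rightarrow> bool" where
  "complete_graph K A \<longleftrightarrow> (\<forall>x\<in>K. \<forall>y\<in>K. x \<noteq> y \<longrightarrow> {x, y} \<in> A)"


section \<open>Edge colorings\<close>

text \<open>The partial graph of color \<open>c\<close> has the edge set below and keeps all vertices, so a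
  vertex on no edge of color \<open>c\<close> is by itself a cell of color \<open>c\<close>.\<close>

definition color_edges :: "'a set set \<Rightarrow> ('a set \<Rightarrow> 'c) \<Rightarrow> 'c \<Rightarrow> 'a set set" where
  "color_edges A col c = {e \<in> A. col e = c}"

definition cells_of_color :: "'a set \<Rightarrow> 'a set set \<Rightarrow> ('a set \<Rightarrow> 'c) \<Rightarrow> 'c \<Rightarrow> 'a set set" where
  "cells_of_color S A col c = graph_components S (color_edges A col c)"

definition cells :: "'a set \<Rightarrow> 'a set set \<Rightarrow> 'c set \<Rightarrow> ('a set \<Rightarrow> 'c) \<Rightarrow> 'a set set" where
  "cells S A C col = (\<Union>c\<in>C. cells_of_color S A col c)"


section \<open>Isometries and fixed points\<close>

definition isometries :: "'a set \<Rightarrow> 'a set set \<Rightarrow> ('a \<Rightarrow> 'a) set" where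
  "isometries S A =
     {g \<in> Bij S. \<forall>x\<in>S. \<forall>y\<in>S. graph_dist S A (g x) (g y) = graph_dist S A x y}"

definition Isom :: "'a set \<Rightarrow> 'a set set \<Rightarrow> ('a \<Rightarrow> 'a) monoid" where
  "Isom S A = BijGroup S \<lparr>carrier := isometries S A\<rparr>"

definition finitely_generated_subgroup :: "('g, 'b) monoid_scheme \<Rightarrow> 'g set \<Rightarrow> bool" where
  "finitely_generated_subgroup M G \<longleftrightarrow>
     subgroup G M \<and> (\<exists>F. finite F \<and> F \<subseteq> carrier M \<and> G = generate M F)"

definition Fix :: "'a set \<Rightarrow> ('a \<Rightarrow> 'a) \<Rightarrow> 'a set" where
  "Fix S g = {x \<in> S. g x = x}"

definition GAF :: "'a set \<Rightarrow> ('a \<Rightarrow> 'a) set \<Rightarrow> bool" where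
  "GAF S G \<longleftrightarrow> (\<forall>g\<in>G. Fix S g \<noteq> {})"

definition GAG :: "'a set \<Rightarrow> ('a \<Rightarrow> 'a) set \<Rightarrow> bool" where
  "GAG S G \<longleftrightarrow> (\<Inter>g\<in>G. Fix S g) \<noteq> {}"

lemma subgroup_isometries: "subgroup (isometries S A) (BijGroup S)"
proof (rule subgroup.intro)
  show "isometries S A \<subseteq> carrier (BijGroup S)"
    by (auto simp: isometries_def BijGroup_def)
next
  fix g h assume "g \<in> isometries S A" "h \<in> isometries S A"
  then show "g \<otimes>\<^bsub>BijGroup S\<^esub> h \<in> isometries S A"
    using Bij_imp_funcset[of h S]
    by (auto simp: isometries_def BijGroup_def compose_Bij compose_eq Pi_iff)
next
  show "\<one>\<^bsub>BijGroup S\<^esub> \<in> isometries S A"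
    by (simp add: isometries_def BijGroup_def id_Bij)
next
  fix g assume g: "g \<in> isometries S A"
  then have B: "g \<in> Bij S" and d: "\<And>x y. x \<in> S \<Longrightarrow> y \<in> S \<Longrightarrow>
      graph_dist S A (g x) (g y) = graph_dist S A x y"
    by (auto simp: isometries_def)
  have r: "g (inv_into S g x) = x" if "x \<in> S" for x
    using B that by (auto simp: Bij_def intro: bij_betw_inv_into_right)
  show "inv\<^bsub>BijGroup S\<^esub> g \<in> isometries S A"
    using d[OF Bij_inv_into_mem[OF B] Bij_inv_into_mem[OF B]] r
    by (simp add: inv_BijGroup[OF B] isometries_def restrict_inv_into_Bij[OF B])
qed

lemma group_Isom: "group (Isom S A)"
  unfolding Isom_def
  by (rule subgroup.subgroup_is_group[OF subgroup_isometries group_BijGroup])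

end

theory Submission
  imports Defs
begin

text \<open>
  A graph as in the theorem is a tree of cliques, and the proof is Serre's argument for groups
  acting on trees, carried out with the graph distance alone.

  Apart from the size of the cells, the coloring matters only through the fact that the
  step from a vertex towards a target \<open>x\<close> is unique, and is even the same for two adjacent vertices equally far from \<open>x\<close>
  (\<open>step_towards_unique\<close>): two different steps would, continued towards \<open>x\<close>, close up to an
  elementary cycle; its color would make vertices adjacent whose distances to \<open>x\<close> differ
  by at least two. Metrics with this property are studied in the locale \<open>block_metric\<close>. There,
  the cell of an edge consists of its ends and their common neighbors, every cell is a clique,
  and every vertex has a unique nearest vertex in each cell, so that an isometry which preserves
  a cell and has some fixed point has one in that cell.

  Generators are added one at a time. Let \<open>H\<close> be the elements fixing what the previous generators
  fix, let \<open>s\<close> be the next one, and choose \<open>y\<close> fixed by \<open>H\<close> and \<open>z\<close> fixed by \<open>s\<close> at minimal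
  distance. If \<open>y \<noteq> z\<close>, let \<open>h \<in> H\<close> move the vertex after \<open>y\<close> on the geodesic from \<open>y\<close> to \<open>z\<close>. A
  fixed point \<open>x\<close> of \<open>s \<circ> h\<close> and its image \<open>h x\<close> have the same distances to \<open>y\<close> and to \<open>z\<close>,
  hence project to the same place of the geodesic. If that place is away from \<open>y\<close>, then \<open>h\<close>
  fixes the vertex after \<open>y\<close>; if it is away from \<open>z\<close>, then \<open>s\<close> fixes the vertex before \<open>z\<close>. What
  remains is that \<open>y\<close> and \<open>z\<close> are adjacent and \<open>x\<close> projects to a third vertex of their cell, and
  then \<open>h\<close> and \<open>s\<close> preserve this cell (\<open>fixed_point_of_composition\<close>). So the problem is reduced to
  permutations of at most four points (\<open>permutations_of_four_points\<close>), where the two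
  fixed points \<open>y\<close> and \<open>z\<close> leave so little room that a fourth vertex of the cell must be fixed
  by everything.
\<close>

section \<open>Permutations of at most four points\<close>

text \<open>A fixed point \<open>b\<close> of \<open>s \<circ> h\<close> is neither \<open>y\<close>, which only \<open>s\<close> moves, nor \<open>z\<close>, which only \<open>h\<close>
  moves. If \<open>h b \<noteq> b\<close>, then the four points
  are \<open>y\<close>, \<open>z\<close>, \<open>b\<close>, \<open>h b\<close>, both maps are forced to be 3-cycles, and \<open>s \<circ> h \<circ> h\<close> turns out to be
  fixed-point free. Otherwise both maps fix \<open>b\<close> and are transpositions through the remaining
  point.\<close>

lemma permutations_of_four_points:
  assumes K: "finite K" "card K \<le> 4" "y \<in> K" "z \<in> K" "y \<noteq> z"
    and h: "h \<in> K \<rightarrow> K" "inj_on h K" "h y = y" "h z \<noteq> z"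
    and s: "s \<in> K \<rightarrow> K" "inj_on s K" "s z = z" "s y \<noteq> y"
    and fixed1: "\<exists>b\<in>K. s (h b) = b"
    and fixed2: "\<exists>b\<in>K. s (h (h b)) = b"
  shows "h z = s y \<and> (\<exists>b. K = {y, z, s y, b} \<and> b \<notin> {y, z, s y} \<and> h b = b \<and> s b = b)"
proof -
  have h_inj: "h u = h v \<longleftrightarrow> u = v" if "u \<in> K" "v \<in> K" for u v
    using h(2) that by (auto simp: inj_on_def)
  have s_inj: "s u = s v \<longleftrightarrow> u = v" if "u \<in> K" "v \<in> K" for u v
    using s(2) that by (auto simp: inj_on_def)
  have maps: "h u \<in> K" "s u \<in> K" if "u \<in> K" for u
    using h(1) s(1) that by auto
  have four: "K = {p, q, u, v}"
    if "p \<in> K" "q \<in> K" "u \<in> K" "v \<in> K" "distinct [p, q, u, v]" for p q u v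
  proof -
    have "card {p, q, u, v} = 4" using that(5) by simp
    then show ?thesis using card_seteq[OF K(1), of "{p, q, u, v}"] K(2) that by simp
  qed
  obtain b where b: "b \<in> K" "s (h b) = b" using fixed1 by blast
  have "b \<noteq> y" using b h(3) s(4) by metis
  have "b \<noteq> z" using b h(4) s(3) s_inj maps K(4) by metis
  have "h b = b"
  proof (rule ccontr)
    define w where "w = h b"
    assume "h b \<noteq> b"
    then have "w \<noteq> b" "w \<in> K" using maps b by (auto simp: w_def)
    moreover have "w \<noteq> y" using h_inj[of b y] b K \<open>b \<noteq> y\<close> h(3) by (simp add: w_def)
    moreover have "w \<noteq> z" using b \<open>b \<noteq> z\<close> s(3) by (auto simp: w_def)
    ultimately have K_eq: "K = {y, z, b, w}"
      using four[of y z b w] b K \<open>b \<noteq> y\<close> \<open>b \<noteq> z\<close> by simp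
    have sw: "s w = b" using b by (simp add: w_def)
    have hb: "h b = w" by (simp add: w_def)
    have hz: "h z = b"
      using maps(1)[of z] h_inj[of z y] h_inj[of z b] hb h(3,4) K b \<open>b \<noteq> z\<close>
      unfolding K_eq by auto
    have hw: "h w = z"
      using maps(1)[of w] h_inj[of w y] h_inj[of w b] h_inj[of w z] hb hz h(3) K b
        \<open>w \<in> K\<close> \<open>w \<noteq> y\<close> \<open>w \<noteq> z\<close> \<open>w \<noteq> b\<close>
      unfolding K_eq by auto
    have sy: "s y = w"
      using maps(2)[of y] s_inj[of y z] s_inj[of y w] sw s(3,4) K \<open>w \<in> K\<close> \<open>w \<noteq> y\<close>
      unfolding K_eq by auto
    have sb: "s b = y"
      using maps(2)[of b] s_inj[of b z] s_inj[of b w] s_inj[of b y] sw sy s(3) K b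
        \<open>w \<in> K\<close> \<open>w \<noteq> b\<close> \<open>b \<noteq> y\<close> \<open>b \<noteq> z\<close>
      unfolding K_eq by auto
    show False
      using fixed2 h(3) s(3) sw hb hz hw sy sb \<open>b \<noteq> y\<close> \<open>b \<noteq> z\<close> \<open>w \<noteq> b\<close> \<open>w \<noteq> y\<close> \<open>w \<noteq> z\<close> K(5)
      unfolding K_eq by auto
  qed
  then have "s b = b" using b by simp
  have "h z \<notin> {y, z, b}"
    using h_inj[of z y] h_inj[of z b] K b \<open>h b = b\<close> h(3,4) \<open>b \<noteq> z\<close> by auto
  then have "K = {y, z, b, h z}"
    using four[of y z b "h z"] K b maps \<open>b \<noteq> y\<close> \<open>b \<noteq> z\<close> by fastforce
  moreover have "s y \<notin> {y, z, b}"
    using s_inj[of y z] s_inj[of y b] K b \<open>s b = b\<close> s(3,4) \<open>b \<noteq> y\<close> by auto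
  moreover have "s y \<in> K" using maps K by blast
  ultimately show ?thesis
    using \<open>h b = b\<close> \<open>s b = b\<close> \<open>b \<noteq> y\<close> \<open>b \<noteq> z\<close> by auto
qed


section \<open>Metrics with unique steps\<close>

text \<open>The metric form of a tree of cliques. The last assumption with \<open>y = z\<close> says that geodesics are
  unique; with \<open>y\<close> and \<open>z\<close> adjacent it says that the two vertices form a triangle with
  the next vertex on the way to \<open>x\<close>.\<close>

locale block_metric =
  fixes S :: "'a set" and d :: "'a \<Rightarrow> 'a \<Rightarrow> nat"
  assumes d_eq_0_iff: "\<lbrakk>x \<in> S; y \<in> S\<rbrakk> \<Longrightarrow> d x y = 0 \<longleftrightarrow> x = y"
    and d_sym: "\<lbrakk>x \<in> S; y \<in> S\<rbrakk> \<Longrightarrow> d x y = d y x"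
    and d_step_le: "\<lbrakk>x \<in> S; y \<in> S; z \<in> S; d y z = 1\<rbrakk> \<Longrightarrow> d x z \<le> Suc (d x y)"
    and step_towards_exists:
      "\<lbrakk>x \<in> S; y \<in> S; d x y = Suc n\<rbrakk> \<Longrightarrow> \<exists>p\<in>S. d x p = n \<and> d p y = 1"
    and step_towards_unique:
      "\<lbrakk>x \<in> S; y \<in> S; z \<in> S; p \<in> S; q \<in> S; d y z \<le> 1; d x y = Suc n; d x z = Suc n;
        d x p = n; d p y = 1; d x q = n; d q z = 1\<rbrakk> \<Longrightarrow> p = q"
begin

lemma d_self [simp]: "x \<in> S \<Longrightarrow> d x x = 0"
  by (simp add: d_eq_0_iff)

lemma d_triangle: "\<lbrakk>x \<in> S; y \<in> S; z \<in> S\<rbrakk> \<Longrightarrow> d x z \<le> d x y + d y z"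
proof (induction "d y z" arbitrary: z)
  case 0
  then show ?case using d_eq_0_iff by fastforce
next
  case (Suc n)
  obtain p where p: "p \<in> S" "d y p = n" "d p z = 1"
    using step_towards_exists[of y z n] Suc by auto
  then have "d x p \<le> d x y + n" using Suc by auto
  then show ?case using d_step_le[of x p z] p Suc by linarith
qed

lemma d_cases_adjacent:
  assumes "y \<in> S" "z \<in> S" "d y z \<le> 1"
  obtains "y = z" | "y \<noteq> z" "d y z = 1" "d z y = 1"
  using assms d_eq_0_iff[of y z] d_sym[of y z] by (cases "d y z") auto

text \<open>Once a geodesic \<open>y\<close>, \<open>p\<close>, \<open>p'\<close> does not approach \<open>x\<close>, it recedes from \<open>x\<close>. Otherwise the
  step from \<open>p\<close> towards \<open>x\<close> would be equal or adjacent to both \<open>y\<close> and \<open>p'\<close>, which would give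
  either an edge or a second geodesic between these two vertices.\<close>

lemma recede_once:
  assumes S: "x \<in> S" "y \<in> S" "p \<in> S" "p' \<in> S"
    and geo: "d y p = 1" "d p p' = 1" "d y p' \<ge> 2"
    and away: "d x y \<le> d x p"
  shows "d x p' = Suc (d x p)"
proof (rule ccontr)
  assume "d x p' \<noteq> Suc (d x p)"
  then have le: "d x p' \<le> d x p" using d_step_le[of x p p'] S geo by linarith
  have "d x p \<noteq> 0" using away d_eq_0_iff S geo by fastforce
  then obtain k where k: "d x p = Suc k" using not0_implies_Suc by blast
  obtain q where q: "q \<in> S" "d x q = k" "d q p = 1"
    using step_towards_exists[OF S(1,3) k] by blast
  have close: "d q v \<le> 1" if v: "v \<in> S" "d v p = 1" "d x v \<le> d x p" for v
  proof (cases "d x v = Suc k")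
    case True
    obtain u where u: "u \<in> S" "d x u = k" "d u v = 1"
      using step_towards_exists[OF S(1) v(1) True] by blast
    have "u = q"
      using step_towards_unique[OF S(1) v(1) S(3) u(1) q(1)] v True k u q by simp
    then show ?thesis using u by simp
  next
    case False
    have "d x p \<le> Suc (d x v)" using d_step_le[of x v p] S v by simp
    then have "d x v = k" using False k v by simp
    then have "v = q"
      using step_towards_unique[OF S(1) S(3) S(3) v(1) q(1)] v k q S by simp
    then show ?thesis using q by simp
  qed
  have qy: "d q y \<le> 1" using close S geo away by simp
  have qp': "d q p' \<le> 1" using close[of p'] S geo le d_sym[of p p'] by simp
  have "d y p' \<le> d y q + d q p'" using d_triangle S q by blast
  then have one: "d y q = 1" "d q p' = 1" "d y p' = Suc 1"
    using qy qp' geo d_sym[of y q] S q by auto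
  then have "q = p"
    using step_towards_unique[OF S(2,4,4) q(1) S(3), of 1] geo S by simp
  then show False using q k by simp
qed

lemma recede:
  assumes "x \<in> S" "z \<in> S"
  shows "\<lbrakk>y \<in> S; p \<in> S; d y z = Suc n; d y p = 1; d p z = n; d x y \<le> d x p\<rbrakk>
    \<Longrightarrow> d x z = d x p + n"
proof (induction n arbitrary: y p)
  case 0
  then show ?case using d_eq_0_iff[of p z] assms by simp
next
  case (Suc n)
  have "d z p = Suc n" using Suc d_sym assms by simp
  then obtain p' where p': "p' \<in> S" "d z p' = n" "d p' p = 1"
    using step_towards_exists[of z p n] Suc assms by blast
  then have p'': "d p' z = n" "d p p' = 1" using d_sym Suc assms by simp_all
  have "d y z \<le> d y p' + d p' z" using d_triangle Suc p' assms by blast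
  then have "d y p' \<ge> 2" using p'' Suc by simp
  then have "d x p' = Suc (d x p)"
    using recede_once[of x y p p'] Suc p' p'' assms by simp
  then show ?case using Suc.IH[of p p'] Suc p' p'' by simp
qed


section \<open>Cells and isometries\<close>

definition cell :: "'a \<Rightarrow> 'a \<Rightarrow> 'a set" where
  "cell y z = {x \<in> S. d x y \<le> 1 \<and> d x z \<le> 1}"

lemma ends_in_cell: "\<lbrakk>y \<in> S; z \<in> S; d y z = 1\<rbrakk> \<Longrightarrow> y \<in> cell y z \<and> z \<in> cell y z"
  using d_sym[of y z] by (simp add: cell_def)

lemma cell_clique:
  assumes S: "y \<in> S" "z \<in> S" "d y z = 1" and ab: "a \<in> cell y z" "b \<in> cell y z"
  shows "d a b \<le> 1"
proof (rule ccontr)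
  assume far: "\<not> d a b \<le> 1"
  have ab': "a \<in> S" "b \<in> S" "d a y \<le> 1" "d a z \<le> 1" "d b y \<le> 1" "d b z \<le> 1"
    using ab by (auto simp: cell_def)
  have sym: "d y b = d b y" "d z b = d b z" using d_sym S ab' by auto
  have "d a b \<le> d a y + d y b" "d a b \<le> d a z + d z b"
    using d_triangle S ab' by blast+
  then have "d a b = Suc 1" "d a y = 1" "d y b = 1" "d a z = 1" "d z b = 1"
    using far ab' sym by linarith+
  then have "y = z"
    using step_towards_unique[OF ab'(1,2,2) S(1,2), of 1] ab' by simp
  then show False using S by simp
qed

lemma cell_eq:
  assumes S: "y \<in> S" "z \<in> S" "d y z = 1" and ab: "a \<in> cell y z" "b \<in> cell y z" "a \<noteq> b"
  shows "d a b = 1" "cell a b = cell y z"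
proof -
  have ab': "a \<in> S" "b \<in> S" using ab by (auto simp: cell_def)
  show ab1: "d a b = 1"
    using d_cases_adjacent[OF ab' cell_clique[OF S ab(1,2)]] ab(3) by blast
  have "y \<in> cell a b" "z \<in> cell a b"
    using ab S d_sym[OF ab'(1)] d_sym[OF ab'(2)] by (simp_all add: cell_def)
  then have "c \<in> cell y z" if c: "c \<in> cell a b" for c
    using cell_clique[OF ab' ab1 c] c by (simp add: cell_def)
  moreover have "c \<in> cell a b" if c: "c \<in> cell y z" for c
    using cell_clique[OF S c] ab c by (simp add: cell_def)
  ultimately show "cell a b = cell y z" by blast
qed

definition isometry :: "('a \<Rightarrow> 'a) \<Rightarrow> bool" where
  "isometry g \<longleftrightarrow> g \<in> S \<rightarrow> S \<and> (\<forall>x\<in>S. \<forall>y\<in>S. d (g x) (g y) = d x y)"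

lemma isometryD:
  assumes "isometry g"
  shows "x \<in> S \<Longrightarrow> g x \<in> S" "\<lbrakk>x \<in> S; y \<in> S\<rbrakk> \<Longrightarrow> d (g x) (g y) = d x y"
  using assms by (auto simp: isometry_def)

lemma isometry_inj: "isometry g \<Longrightarrow> inj_on g S"
  by (rule inj_onI) (metis d_eq_0_iff isometryD)

lemma isometry_comp: "\<lbrakk>isometry g; isometry h\<rbrakk> \<Longrightarrow> isometry (\<lambda>x. g (h x))"
  by (auto simp: isometry_def Pi_iff)

lemma isometry_preserves_cell:
  assumes S: "y \<in> S" "z \<in> S" "d y z = 1" and g: "isometry g"
    and ab: "a \<in> cell y z" "b \<in> cell y z" "a \<noteq> b" "g a \<in> cell y z" "g b \<in> cell y z"
  shows "g \<in> cell y z \<rightarrow> cell y z"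
proof
  fix c assume "c \<in> cell y z"
  then have "c \<in> cell a b" using cell_eq[OF S ab(1-3)] by simp
  then have "g c \<in> cell (g a) (g b)"
    using isometryD[OF g] ab by (auto simp: cell_def)
  moreover have "g a \<noteq> g b"
    using isometry_inj[OF g] ab by (auto simp: cell_def inj_on_def)
  ultimately show "g c \<in> cell y z" using cell_eq[OF S ab(4,5)] by simp
qed

text \<open>The vertex of the cell nearest to a fixed point is unique: the step from two nearest ones
  towards the fixed point would be common to both, hence in the cell and nearer.\<close>

lemma fixed_point_in_cell:
  assumes S: "y \<in> S" "z \<in> S" "d y z = 1" and g: "isometry g"
    and stab: "g \<in> cell y z \<rightarrow> cell y z" and x: "x \<in> S" "g x = x"
  shows "\<exists>k\<in>cell y z. g k = k"
proof -
  have "y \<in> cell y z" using ends_in_cell[OF S] by blast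
  then obtain k where k: "k \<in> cell y z" and least: "\<And>v. v \<in> cell y z \<Longrightarrow> d x k \<le> d x v"
    using ex_has_least_nat[of "\<lambda>v. v \<in> cell y z" y "d x"] by blast
  have gk: "g k \<in> cell y z" using stab k by blast
  have kS: "k \<in> S" "g k \<in> S" using k gk by (auto simp: cell_def)
  have dgk: "d x (g k) = d x k" using isometryD(2)[OF g x(1) kS(1)] x by simp
  have "g k = k"
  proof (rule ccontr)
    assume ne: "g k \<noteq> k"
    then have "d x k \<noteq> 0" using d_eq_0_iff x kS by auto
    then obtain m where m: "d x k = Suc m" using not0_implies_Suc by blast
    obtain u where u: "u \<in> S" "d x u = m" "d u k = 1"
      using step_towards_exists[OF x(1) kS(1) m] by blast
    obtain v where v: "v \<in> S" "d x v = m" "d v (g k) = 1"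
      using step_towards_exists[OF x(1) kS(2)] dgk m by metis
    have "d k (g k) = 1" and eq: "cell k (g k) = cell y z"
      using cell_eq[OF S k gk] ne by auto
    then have "u = v"
      using step_towards_unique[OF x(1) kS u(1) v(1)] u v m dgk by simp
    then have "u \<in> cell y z" using u v unfolding eq[symmetric] by (simp add: cell_def)
    then show False using least u m by fastforce
  qed
  then show ?thesis using k by blast
qed

text \<open>Here \<open>p\<close> and \<open>r\<close> are the second and the last but one vertex of the geodesic from \<open>y\<close> to \<open>z\<close>.
  The vertices \<open>x\<close> and \<open>h x\<close> have the same distances to \<open>y\<close> and \<open>z\<close>. If the way from \<open>x\<close> to \<open>y\<close> led
  through \<open>p\<close>, then so would the way from \<open>h x\<close> to \<open>y\<close>, and \<open>h\<close> would fix \<open>p\<close>. So \<open>p\<close> is no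
  nearer to \<open>x\<close> than \<open>y\<close> is and, symmetrically, \<open>r\<close> is no nearer to \<open>h x\<close> than \<open>z\<close> is. By \<open>recede\<close>
  each of the two common distances, to \<open>y\<close> and to \<open>z\<close>, exceeds the other by at least \<open>n\<close>, which
  leaves \<open>n = 0\<close> and equality.\<close>

lemma fixed_point_of_composition:
  assumes h: "isometry h" "h y = y" and s: "isometry s" "s z = z"
    and S: "y \<in> S" "z \<in> S" "p \<in> S" "r \<in> S"
    and dist: "d y z = Suc n"
    and p: "d y p = 1" "d p z = n" "h p \<noteq> p"
    and r: "d y r = n" "d r z = 1" "s r \<noteq> r"
    and x: "x \<in> S" "s (h x) = x"
  shows "n = 0 \<and> h \<in> cell y z \<rightarrow> cell y z \<and> s \<in> cell y z \<rightarrow> cell y z"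
proof -
  define w where "w = h x"
  have w: "w \<in> S" "s w = x" using x isometryD(1)[OF h(1)] by (auto simp: w_def)
  have wy: "d w y = d x y" using isometryD(2)[OF h(1) x(1) S(1)] h(2) by (simp add: w_def)
  have wz: "d w z = d x z" using isometryD(2)[OF s(1) w(1) S(2)] s(2) w(2) by simp
  note sym = d_sym[OF S(1,2)] d_sym[OF S(1,3)] d_sym[OF S(3,2)] d_sym[OF S(1,4)]
    d_sym[OF S(4,2)]
  have away_p: "d x y \<le> d x p"
  proof (rule ccontr)
    assume near: "\<not> d x y \<le> d x p"
    have "d x y \<le> Suc (d x p)" using d_step_le[of x p y] S x p sym by simp
    then have xp: "d x y = Suc (d x p)" using near by simp
    have "d x z \<le> d x p + n" using d_triangle[of x p z] S x p by simp
    have "\<not> d w y \<le> d w p"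
    proof
      assume "d w y \<le> d w p"
      then have "d w z \<ge> d w y + n"
        using recede[OF w(1) S(2,1,3) dist p(1,2)] by simp
      then show False using wz wy xp \<open>d x z \<le> d x p + n\<close> by simp
    qed
    moreover have "d w y \<le> Suc (d w p)" using d_step_le[of w p y] S w p sym by simp
    ultimately have wp: "d w p = d x p" using wy xp by simp
    have "d w (h p) = d x p" "d (h p) y = 1"
      using isometryD(2)[OF h(1) x(1) S(3)] isometryD(2)[OF h(1) S(3,1)] h(2) p sym
      by (auto simp: w_def)
    then have "h p = p"
      using step_towards_unique[OF w(1) S(1,1) isometryD(1)[OF h(1) S(3)] S(3)] wp wy xp p sym S
      by simp
    then show False using p by simp
  qed
  have away_r: "d w z \<le> d w r"
  proof (rule ccontr)
    assume near: "\<not> d w z \<le> d w r"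
    have "d w z \<le> Suc (d w r)" using d_step_le[of w r z] S w r by simp
    then have wr: "d w z = Suc (d w r)" using near by simp
    have "d w y \<le> d w r + n" using d_triangle[of w r y] S w r sym by simp
    have "\<not> d x z \<le> d x r"
    proof
      assume "d x z \<le> d x r"
      then have "d x y \<ge> d x z + n"
        using recede[OF x(1) S(1,2,4)] dist r sym by fastforce
      then show False using wz wy wr \<open>d w y \<le> d w r + n\<close> by simp
    qed
    moreover have "d x z \<le> Suc (d x r)" using d_step_le[of x r z] S x r by simp
    ultimately have xr: "d x r = d w r" using wz wr by simp
    have "d x (s r) = d w r" "d (s r) z = 1"
      using isometryD(2)[OF s(1) w(1) S(4)] isometryD(2)[OF s(1) S(4,2)] s(2) r w(2) by auto
    then have "s r = r"
      using step_towards_unique[OF x(1) S(2,2) isometryD(1)[OF s(1) S(4)] S(4)] xr wz wr r S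
      by simp
    then show False using r by simp
  qed
  have "d x z \<ge> d x y + n"
    using recede[OF x(1) S(2,1,3) dist p(1,2)] away_p by simp
  moreover have "d w y \<ge> d w z + n"
    using recede[OF w(1) S(1,2,4)] away_r dist r sym by fastforce
  ultimately have n: "n = 0" and eq: "d x y = d x z" using wy wz by auto
  have yz: "d y z = 1" "y \<noteq> z" using dist n S by auto
  have "d x y \<noteq> 0" using eq yz d_eq_0_iff x S by metis
  then obtain m where m: "d x y = Suc m" using not0_implies_Suc by blast
  \<comment> \<open>The projection of \<open>x\<close> to the cell is carried by \<open>h\<close> to that of \<open>h x\<close>, and back by \<open>s\<close>.
      So each map sends two vertices of the cell into the cell, which is enough to preserve it.\<close>
  have gate: "\<exists>q\<in>S. d v q = m \<and> d q y = 1 \<and> d q z = 1"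
    if v: "v \<in> S" "d v y = Suc m" "d v z = Suc m" for v
  proof -
    obtain q where q: "q \<in> S" "d v q = m" "d q y = 1"
      using step_towards_exists[OF v(1) S(1) v(2)] by blast
    obtain q' where q': "q' \<in> S" "d v q' = m" "d q' z = 1"
      using step_towards_exists[OF v(1) S(2) v(3)] by blast
    have "q = q'"
      using step_towards_unique[OF v(1) S(1,2) q(1) q'(1)] yz v q q' by simp
    then show ?thesis using q q' by blast
  qed
  obtain q where q: "q \<in> S" "d x q = m" "d q y = 1" "d q z = 1"
    using gate[OF x(1)] m eq by auto
  obtain q' where q': "q' \<in> S" "d w q' = m" "d q' y = 1" "d q' z = 1"
    using gate[OF w(1)] m eq wy wz by auto
  have "d w (h q) = m" "d (h q) y = 1"
    using isometryD(2)[OF h(1) x(1) q(1)] isometryD(2)[OF h(1) q(1) S(1)] q h(2)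
    by (auto simp: w_def)
  then have hq: "h q = q'"
    using step_towards_unique[OF w(1) S(1,1) isometryD(1)[OF h(1) q(1)] q'(1)] m wy q' S by simp
  have "d x (s q') = m" "d (s q') z = 1"
    using isometryD(2)[OF s(1) w(1) q'(1)] isometryD(2)[OF s(1) q'(1) S(2)] q' s(2) w(2) by auto
  then have sq': "s q' = q"
    using step_towards_unique[OF x(1) S(2,2) isometryD(1)[OF s(1) q'(1)] q(1)] m eq q S by simp
  have in_cell: "q \<in> cell y z" "q' \<in> cell y z" "y \<in> cell y z" "z \<in> cell y z"
    using q q' ends_in_cell[OF S(1,2) yz(1)] by (auto simp: cell_def)
  have ne: "q \<noteq> y" "q' \<noteq> z" using q q' S by auto
  have "h \<in> cell y z \<rightarrow> cell y z"
    by (rule isometry_preserves_cell[OF S(1,2) yz(1) h(1) in_cell(1,3) ne(1)])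
      (simp_all add: hq h(2) in_cell)
  moreover have "s \<in> cell y z \<rightarrow> cell y z"
    by (rule isometry_preserves_cell[OF S(1,2) yz(1) s(1) in_cell(2,4) ne(2)])
      (simp_all add: sq' s(2) in_cell)
  ultimately show ?thesis using n by blast
qed


section \<open>Common fixed points\<close>

text \<open>By \<open>permutations_of_four_points\<close>, every element of \<open>H\<close> that moves \<open>z\<close> sends it to \<open>s y\<close> and
  fixes the same fourth vertex \<open>b\<close> of the cell, as does \<open>s\<close>. An element of \<open>H\<close> that fixes \<open>z\<close>
  becomes one that moves \<open>z\<close> when composed with such an element, so it fixes \<open>b\<close> as well.\<close>

lemma common_fixed_point_step:
  assumes small: "\<And>y z. \<lbrakk>y \<in> S; z \<in> S; d y z = 1\<rbrakk> \<Longrightarrow> finite (cell y z) \<and> card (cell y z) \<le> 4"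
    and H: "\<And>h. h \<in> H \<Longrightarrow> isometry h"
    and comp: "\<And>g h. \<lbrakk>g \<in> H; h \<in> H\<rbrakk> \<Longrightarrow> compose S g h \<in> H"
    and H_fixed: "\<exists>y\<in>S. \<forall>h\<in>H. h y = y"
    and s: "isometry s" "\<exists>z\<in>S. s z = z"
    and sH_fixed: "\<And>h. h \<in> H \<Longrightarrow> \<exists>x\<in>S. s (h x) = x"
  shows "\<exists>b\<in>S. (\<forall>h\<in>H. h b = b) \<and> s b = b"
proof -
  define Y where "Y = {y \<in> S. \<forall>h\<in>H. h y = y}"
  define Z where "Z = {z \<in> S. s z = z}"
  obtain y0 z0 where "y0 \<in> Y" "z0 \<in> Z" using H_fixed s(2) by (auto simp: Y_def Z_def)
  then obtain y z where yz: "y \<in> Y" "z \<in> Z"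
    and least: "\<And>y' z'. \<lbrakk>y' \<in> Y; z' \<in> Z\<rbrakk> \<Longrightarrow> d y z \<le> d y' z'"
    using ex_has_least_nat[of "\<lambda>(u, v). u \<in> Y \<and> v \<in> Z" "(y0, z0)" "\<lambda>(u, v). d u v"] by auto
  have S: "y \<in> S" "z \<in> S" and sz: "s z = z" using yz by (auto simp: Y_def Z_def)
  have hy: "h y = y" if "h \<in> H" for h using yz that by (auto simp: Y_def)
  show ?thesis
  proof (cases "d y z")
    case 0
    then show ?thesis using yz d_eq_0_iff S by (auto simp: Y_def Z_def)
  next
    case (Suc n)
    have "d z y = Suc n" using Suc d_sym S by simp
    then obtain p where p: "p \<in> S" "d z p = n" "d p y = 1"
      using step_towards_exists[of z y] S by blast
    then have p': "d y p = 1" "d p z = n" using d_sym S by simp_all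
    have "p \<notin> Y" using least[of p z] yz p' Suc by auto
    then obtain h0 where h0: "h0 \<in> H" "h0 p \<noteq> p" using p by (auto simp: Y_def)
    obtain r where r: "r \<in> S" "d y r = n" "d r z = 1"
      using step_towards_exists[OF S Suc] by blast
    have "r \<notin> Z" using least[of y r] yz r Suc by auto
    then have sr: "s r \<noteq> r" using r by (auto simp: Z_def)
    obtain x0 where "x0 \<in> S" "s (h0 x0) = x0" using sH_fixed h0 by blast
    then have n: "n = 0"
      using fixed_point_of_composition[OF H[OF h0(1)] hy[OF h0(1)] s(1) sz S p(1) r(1) Suc p' h0(2)
          r(2,3) sr] by blast
    have d1: "d y z = 1" and ne: "y \<noteq> z" using n Suc S by auto
    have "p = z" "r = y" using n p p' r d_eq_0_iff S by auto
    then have h0z: "h0 z \<noteq> z" and sy: "s y \<noteq> y" using h0 sr by auto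
    let ?K = "cell y z"
    note Kfin = small[OF S d1]
    have K: "y \<in> ?K" "z \<in> ?K" using ends_in_cell[OF S d1] by auto
    have KS: "?K \<subseteq> S" by (auto simp: cell_def)
    have moving: "h z = s y \<and> (\<exists>b. ?K = {y, z, s y, b} \<and> b \<notin> {y, z, s y} \<and> h b = b \<and> s b = b)"
      if h: "h \<in> H" "h z \<noteq> z" for h
    proof -
      obtain x where x: "x \<in> S" "s (h x) = x" using sH_fixed h by blast
      have stab: "h \<in> ?K \<rightarrow> ?K" "s \<in> ?K \<rightarrow> ?K"
        using fixed_point_of_composition[OF H[OF h(1)] hy[OF h(1)] s(1) sz S S(2,1), of 0]
          d1 h(2) sy S x by auto
      have iso2: "isometry (\<lambda>x. h (h x))"
        using isometry_comp H h by blast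
      have stab1: "(\<lambda>x. s (h x)) \<in> ?K \<rightarrow> ?K" and stab2: "(\<lambda>x. s (h (h x))) \<in> ?K \<rightarrow> ?K"
        using stab by auto
      have fixed1: "\<exists>b\<in>?K. s (h b) = b"
        using fixed_point_in_cell[OF S d1 isometry_comp[OF s(1) H[OF h(1)]] stab1] x by blast
      obtain x' where "x' \<in> S" "s (h (h x')) = x'"
        using sH_fixed[OF comp[OF h(1) h(1)]] by (auto simp: compose_def split: if_splits)
      then have fixed2: "\<exists>b\<in>?K. s (h (h b)) = b"
        using fixed_point_in_cell[OF S d1 isometry_comp[OF s(1) iso2] stab2] by blast
      show ?thesis
        using permutations_of_four_points[of ?K y z h s] Kfin K ne stab hy[OF h(1)] h(2) sz sy
          fixed1 fixed2 inj_on_subset[OF isometry_inj KS] H[OF h(1)] s(1) by blast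
    qed
    obtain b where b: "?K = {y, z, s y, b}" "b \<notin> {y, z, s y}" "h0 b = b" "s b = b"
      using moving[OF h0(1) h0z] by blast
    have bS: "b \<in> S" using b KS by blast
    have moving_b: "h b = b" if "h \<in> H" "h z \<noteq> z" for h
      using moving[OF that] b by auto
    have "h b = b" if h: "h \<in> H" for h
    proof (cases "h z = z")
      case True
      have h0zS: "h0 z \<in> S" using isometryD(1)[OF H[OF h0(1)]] S by blast
      have "h (h0 z) \<noteq> z"
        using isometry_inj[OF H[OF h]] True h0z h0zS S by (metis inj_on_eq_iff)
      then have "compose S h h0 z \<noteq> z" using S by (simp add: compose_eq)
      then have "compose S h h0 b = b" using moving_b comp h h0 by blast
      then show ?thesis using b bS by (simp add: compose_eq)
    qed (use moving_b h in blast)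
    then show ?thesis using b bS by blast
  qed
qed

text \<open>The elements fixing every common fixed point of \<open>F\<close> form a set \<open>H\<close> that is closed under
  composition and contains \<open>F\<close>, so that \<open>H\<close> has the same common fixed points as \<open>F\<close>.\<close>

lemma common_fixed_point_finite:
  assumes small: "\<And>y z. \<lbrakk>y \<in> S; z \<in> S; d y z = 1\<rbrakk> \<Longrightarrow> finite (cell y z) \<and> card (cell y z) \<le> 4"
    and G: "\<And>g. g \<in> G \<Longrightarrow> isometry g" "G \<noteq> {}"
    and comp: "\<And>g h. \<lbrakk>g \<in> G; h \<in> G\<rbrakk> \<Longrightarrow> compose S g h \<in> G"
    and G_fixed: "\<And>g. g \<in> G \<Longrightarrow> \<exists>x\<in>S. g x = x"
    and F: "finite F" "F \<subseteq> G"
  shows "\<exists>x\<in>S. \<forall>f\<in>F. f x = x"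
  using F
proof (induction F rule: finite_induct)
  case empty
  then show ?case using G(2) G_fixed by blast
next
  case (insert s F)
  define Y where "Y = {y \<in> S. \<forall>f\<in>F. f y = y}"
  define H where "H = {g \<in> G. \<forall>y\<in>Y. g y = y}"
  have "\<exists>b\<in>S. (\<forall>h\<in>H. h b = b) \<and> s b = b"
  proof (rule common_fixed_point_step[OF small])
    show "isometry h" if "h \<in> H" for h using that G by (auto simp: H_def)
    show "compose S g h \<in> H" if "g \<in> H" "h \<in> H" for g h
      using that comp by (auto simp: H_def Y_def compose_eq)
    show "\<exists>y\<in>S. \<forall>h\<in>H. h y = y" using insert by (auto simp: H_def Y_def)
    show "isometry s" "\<exists>z\<in>S. s z = z" using insert G G_fixed by auto
    show "\<exists>x\<in>S. s (h x) = x" if "h \<in> H" for h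
    proof -
      have "compose S s h \<in> G" using that comp insert by (auto simp: H_def)
      then show ?thesis using G_fixed by (fastforce simp: compose_eq)
    qed
  qed
  moreover have "F \<subseteq> H" using insert by (auto simp: H_def Y_def)
  ultimately show ?case by auto
qed

end


section \<open>The distance of a connected graph\<close>

lemma path_between_snoc:
  "\<lbrakk>path_between S A x p y; {y, z} \<in> A; z \<in> S\<rbrakk> \<Longrightarrow> path_between S A x (p @ [z]) z"
  by (auto simp: path_between_def successively_append_iff)

lemma path_between_Cons:
  "\<lbrakk>path_between S A y p z; {x, y} \<in> A; x \<in> S\<rbrakk> \<Longrightarrow> path_between S A x (x # p) z"
  by (auto simp: path_between_def successively_Cons)

lemma path_between_rev: "path_between S A x p y \<Longrightarrow> path_between S A y (rev p) x"
  by (auto simp: path_between_def hd_rev last_rev successively_rev insert_commute)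

locale connected_simple_graph =
  fixes S :: "'a set" and A :: "'a set set"
  assumes simple: "simple_graph S A" and connected: "connected_graph S A"
begin

abbreviation dist :: "'a \<Rightarrow> 'a \<Rightarrow> nat" where
  "dist \<equiv> graph_dist S A"

lemma edgeD:
  assumes "{u, v} \<in> A"
  shows "u \<in> S" "v \<in> S" "u \<noteq> v"
  using assms simple by (auto simp: simple_graph_def doubleton_eq_iff)

lemma shortest_path:
  assumes "x \<in> S" "y \<in> S"
  obtains p where "path_between S A x p y" "length p = Suc (dist x y)"
proof -
  obtain p where p: "path_between S A x p y"
    using connected assms by (auto simp: connected_graph_def joined_def)
  then have "length p = Suc (length p - 1)" by (auto simp: path_between_def)
  then have "\<exists>n. \<exists>p. path_between S A x p y \<and> length p = Suc n" using p by blast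
  from LeastI_ex[OF this] show thesis
    using that unfolding graph_dist_def by blast
qed

lemma dist_less_length:
  assumes p: "path_between S A x p y"
  shows "dist x y < length p"
proof -
  have "length p = Suc (length p - 1)" using p by (auto simp: path_between_def)
  then have "dist x y \<le> length p - 1"
    unfolding graph_dist_def using p by (intro Least_le) blast
  then show ?thesis using \<open>length p = Suc (length p - 1)\<close> by simp
qed

lemma dist_eq_0_iff:
  assumes "x \<in> S" "y \<in> S"
  shows "dist x y = 0 \<longleftrightarrow> x = y"
proof
  assume "dist x y = 0"
  with shortest_path[OF assms] obtain p where "path_between S A x p y" "length p = 1"
    by (metis One_nat_def)
  then show "x = y" by (auto simp: path_between_def length_Suc_conv)
next
  assume "x = y"
  then have "path_between S A x [x] y" using assms by (simp add: path_between_def)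
  then show "dist x y = 0" using dist_less_length by fastforce
qed

lemma dist_le_sym: "\<lbrakk>x \<in> S; y \<in> S\<rbrakk> \<Longrightarrow> dist y x \<le> dist x y"
  by (metis shortest_path dist_less_length path_between_rev length_rev less_Suc_eq_le)

lemma dist_sym: "\<lbrakk>x \<in> S; y \<in> S\<rbrakk> \<Longrightarrow> dist x y = dist y x"
  by (simp add: dist_le_sym le_antisym)

lemma dist_edge_le:
  assumes "x \<in> S" "{y, z} \<in> A"
  shows "dist x z \<le> Suc (dist x y)"
proof -
  obtain p where "path_between S A x p y" "length p = Suc (dist x y)"
    using shortest_path assms edgeD by metis
  then show ?thesis
    using dist_less_length[OF path_between_snoc[of S A x p y z]] assms edgeD by fastforce
qed

lemma edge_towards_exists:
  assumes "x \<in> S" "y \<in> S" "dist x y = Suc n"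
  shows "\<exists>p. dist x p = n \<and> {p, y} \<in> A"
proof -
  obtain l where l: "path_between S A x l y" "length l = Suc (Suc n)"
    using shortest_path assms by metis
  define q where "q = butlast l"
  have "l = q @ [y]" using l append_butlast_last_id[of l] by (auto simp: q_def path_between_def)
  moreover have "q \<noteq> []" using l(2) \<open>l = q @ [y]\<close> by auto
  ultimately have q: "path_between S A x q (last q)" "{last q, y} \<in> A"
    using l(1) by (auto simp: path_between_def successively_append_iff)
  have "dist x (last q) \<le> n" using dist_less_length[OF q(1)] l(2) \<open>l = q @ [y]\<close> by simp
  moreover have "Suc n \<le> Suc (dist x (last q))" using dist_edge_le[OF assms(1) q(2)] assms by simp
  ultimately show ?thesis using q by auto
qed

lemma dist_eq_1_iff:
  assumes "x \<in> S" "y \<in> S"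
  shows "dist x y = 1 \<longleftrightarrow> {x, y} \<in> A"
proof
  assume "dist x y = 1"
  then obtain p where "dist x p = 0" "{p, y} \<in> A"
    using edge_towards_exists[OF assms] by auto
  then show "{x, y} \<in> A" using dist_eq_0_iff[of x p] assms edgeD by metis
next
  assume e: "{x, y} \<in> A"
  have "dist x y \<le> Suc (dist x x)" using dist_edge_le[OF assms(1) e] .
  then have "dist x y \<le> 1" using dist_eq_0_iff[of x x] assms by simp
  moreover have "dist x y \<noteq> 0" using dist_eq_0_iff assms edgeD(3)[OF e] by simp
  ultimately show "dist x y = 1" by simp
qed

end


section \<open>Graphs whose elementary cycles are monochromatic\<close>

locale cell_graph = connected_simple_graph S A
  for S :: "'a set" and A :: "'a set set" +
  fixes C :: "'c set" and col :: "'a set \<Rightarrow> 'c"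
  assumes col_in: "col \<in> A \<rightarrow> C"
    and cycle_monochromatic: "\<And>p e f. \<lbrakk>elementary_cycle S A p; e \<in> path_edges p;
        f \<in> path_edges p\<rbrakk> \<Longrightarrow> col e = col f"
    and color_cell_complete: "\<And>c K. \<lbrakk>c \<in> C; K \<in> cells_of_color S A col c\<rbrakk>
        \<Longrightarrow> complete_graph K (color_edges A col c)"
begin

lemma first_edges_same_color:
  assumes "elementary_cycle S A (u # v # w # l)"
  shows "col {u, v} = col {v, w}"
proof -
  have "{u, v} \<in> path_edges (u # v # w # l)"
    unfolding path_edges_def by (rule CollectI, rule exI[of _ 0]) simp
  moreover have "{v, w} \<in> path_edges (u # v # w # l)"
    unfolding path_edges_def by (rule CollectI, rule exI[of _ 1]) simp
  ultimately show ?thesis using cycle_monochromatic assms by blast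
qed

lemma same_color_transitive:
  assumes e: "{u, v} \<in> A" "{v, w} \<in> A" "col {u, v} = col {v, w}" "u \<noteq> w"
  shows "{u, w} \<in> A"
proof -
  let ?E = "color_edges A col (col {u, v})"
  let ?K = "{y \<in> S. joined S ?E u y}"
  have S: "u \<in> S" "v \<in> S" "w \<in> S" using e edgeD by auto
  have c: "col {u, v} \<in> C" using col_in e by blast
  have "path_between S ?E u [u] u" "path_between S ?E u [u, v, w] w"
    using S e by (auto simp: path_between_def color_edges_def)
  then have "u \<in> ?K" "w \<in> ?K" using S by (auto simp: joined_def)
  moreover have "complete_graph ?K ?E"
    using color_cell_complete[OF c, of ?K] S
    by (auto simp: cells_of_color_def graph_components_def)
  ultimately have "{u, w} \<in> ?E" using e(4) unfolding complete_graph_def by blast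
  then show ?thesis by (simp add: color_edges_def)
qed

text \<open>Two vertices equally far from \<open>x\<close> are not joined by an elementary path whose inner vertices are
  all farther away. Extending it at both ends towards \<open>x\<close> gives a path of the same kind nearer to \<open>x\<close>, until the two new ends
  coincide. Then the path has closed up to an elementary cycle; the color of the cycle makes the
  new end adjacent to the third vertex, although their distances to \<open>x\<close> differ by two at least.\<close>

lemma no_detour:
  assumes "x \<in> S"
  shows "\<lbrakk>ts \<noteq> []; path_between S A p (p # ts @ [q]) q; distinct (p # ts @ [q]);
    dist x p = n; dist x q = n; \<And>t. t \<in> set ts \<Longrightarrow> n < dist x t\<rbrakk> \<Longrightarrow> False"
proof (induction n arbitrary: p q ts)
  case 0
  then have "p = x" "q = x" using dist_eq_0_iff assms by (auto simp: path_between_def)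
  then show ?case using 0 by simp
next
  case (Suc n)
  have S: "p \<in> S" "q \<in> S" using Suc.prems by (auto simp: path_between_def)
  obtain u where u: "dist x u = n" "{u, p} \<in> A"
    using edge_towards_exists[OF assms S(1)] Suc.prems by blast
  obtain v where v: "dist x v = n" "{v, q} \<in> A"
    using edge_towards_exists[OF assms S(2)] Suc.prems by blast
  have path: "path_between S A u (u # p # ts @ [q] @ [v]) v"
    using path_between_Cons[OF path_between_snoc[OF Suc.prems(2), of v]] u v edgeD
    by (simp add: insert_commute)
  have far: "n < dist x t" if "t \<in> set (p # ts @ [q])" for t
    using that Suc.prems(4-6) by fastforce
  show ?case
  proof (cases "u = v")
    case False
    have "distinct (u # (p # ts @ [q]) @ [v])"
      using Suc.prems(3) False far[of u] far[of v] u v by auto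
    then show ?thesis
      using Suc.IH[of "p # ts @ [q]" u v] path u v far by simp
  next
    case True
    obtain t l where ts: "ts = t # l" using Suc.prems(1) by (cases ts) auto
    have "distinct (p # ts @ [q, u])" using Suc.prems(3) far[of u] u by auto
    then have "elementary_cycle S A (u # p # t # l @ [q, u])"
      using path True ts by (simp add: elementary_cycle_def)
    then have "col {u, p} = col {p, t}" by (rule first_edges_same_color)
    moreover have "{p, t} \<in> A" using Suc.prems(2) ts by (auto simp: path_between_def)
    moreover have t: "Suc n < dist x t" using Suc.prems(6) ts by simp
    moreover have "u \<noteq> t" using t u by auto
    ultimately have "{u, t} \<in> A" using same_color_transitive[OF u(2)] by blast
    then show ?thesis using dist_edge_le[OF assms] t u by fastforce
  qed
qed

sublocale block_metric S dist
proof
  fix x y assume S: "x \<in> S" "y \<in> S"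
  show "dist x y = 0 \<longleftrightarrow> x = y" by (rule dist_eq_0_iff[OF S])
  show "dist x y = dist y x" by (rule dist_sym[OF S])
  show "\<exists>p\<in>S. dist x p = n \<and> dist p y = 1" if "dist x y = Suc n" for n
    using edge_towards_exists[OF S that] edgeD dist_eq_1_iff by metis
next
  fix x y z assume "x \<in> S" "y \<in> S" "z \<in> S" "dist y z = 1"
  then show "dist x z \<le> Suc (dist x y)" using dist_edge_le dist_eq_1_iff by blast
next
  fix x y z p q n
  assume S: "x \<in> S" "y \<in> S" "z \<in> S" "p \<in> S" "q \<in> S"
    and yz: "dist y z \<le> 1" "dist x y = Suc n" "dist x z = Suc n"
    and p: "dist x p = n" "dist p y = 1" and q: "dist x q = n" "dist q z = 1"
  have e: "{p, y} \<in> A" "{z, q} \<in> A"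
    using p q S dist_eq_1_iff by (auto simp: insert_commute)
  have ne: "p \<noteq> y" "p \<noteq> z" "q \<noteq> y" "q \<noteq> z" using p q yz by auto
  show "p = q"
  proof (rule ccontr)
    assume "p \<noteq> q"
    show False
    proof (cases "y = z")
      case True
      have "path_between S A p (p # [y] @ [q]) q"
        using S e True by (simp add: path_between_def)
      then show False
        using no_detour[OF S(1), of "[y]" p q n] p q yz ne \<open>p \<noteq> q\<close> by simp
    next
      case False
      then have "dist y z = 1" using yz(1) dist_eq_0_iff S by (cases "dist y z") auto
      then have "{y, z} \<in> A" using dist_eq_1_iff S by blast
      then have "path_between S A p (p # [y, z] @ [q]) q"
        using S e by (simp add: path_between_def)
      moreover have "n < dist x t" if "t \<in> set [y, z]" for t using that yz by auto
      ultimately show False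
        using no_detour[OF S(1), of "[y, z]" p q n] p q ne False \<open>p \<noteq> q\<close> by simp
    qed
  qed
qed

text \<open>A common neighbor of the ends of an edge forms with it a triangle; this elementary cycle is
  monochromatic, so the neighbor lies in the color cell of the edge. This transfers the bound on
  the size of the color cells.\<close>

lemma cell_within_color_cell:
  assumes S: "y \<in> S" "z \<in> S" "dist y z = 1"
  shows "\<exists>K\<in>cells S A C col. cell y z \<subseteq> K"
proof -
  let ?c = "col {y, z}"
  let ?K = "{v \<in> S. joined S (color_edges A col ?c) y v}"
  have yz: "{y, z} \<in> A" using dist_eq_1_iff S by blast
  have "?c \<in> C" using col_in yz by blast
  then have K: "?K \<in> cells S A C col"
    using S by (auto simp: cells_def cells_of_color_def graph_components_def)
  have "v \<in> ?K" if v: "v \<in> cell y z" for v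
  proof -
    have vS: "v \<in> S" "dist v y \<le> 1" "dist v z \<le> 1" using v by (auto simp: cell_def)
    consider "v = y" | "v = z" | "v \<noteq> y" "v \<noteq> z" by blast
    then have "\<exists>l. path_between S (color_edges A col ?c) y l v"
    proof cases
      case 1
      then show ?thesis using S by (intro exI[of _ "[y]"]) (simp add: path_between_def)
    next
      case 2
      then show ?thesis using S yz
        by (intro exI[of _ "[y, z]"]) (simp add: path_between_def color_edges_def)
    next
      case 3
      then have e: "{v, y} \<in> A" "{z, v} \<in> A"
        using d_cases_adjacent[OF vS(1) S(1) vS(2)] d_cases_adjacent[OF vS(1) S(2) vS(3)]
          dist_eq_1_iff vS S by metis+
      have "elementary_cycle S A [y, z, v, y]"
        using 3 S vS e yz edgeD(3)[OF yz] by (auto simp: elementary_cycle_def path_between_def)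
      then have "col {z, v} = ?c" using first_edges_same_color by metis
      then show ?thesis using S vS e yz
        by (intro exI[of _ "[y, z, v]"]) (simp add: path_between_def color_edges_def)
    qed
    then show ?thesis using vS by (simp add: joined_def)
  qed
  then show ?thesis using K by blast
qed

lemma isometries_imp_isometry: "g \<in> isometries S A \<Longrightarrow> isometry g"
  by (auto simp: isometries_def isometry_def Bij_def dest: bij_betwE)

end


section \<open>Finitely generated groups of isometries\<close>

lemma generate_Isom_fixes:
  assumes "F \<subseteq> carrier (Isom S A)" and x: "x \<in> S" "\<And>f. f \<in> F \<Longrightarrow> f x = x"
    and "g \<in> generate (Isom S A) F"
  shows "g x = x"
  using assms(4)
proof (induction rule: generate.induct)
  case one
  then show ?case using x by (simp add: Isom_def BijGroup_def)
next
  case (incl f)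
  then show ?case using x by blast
next
  case (inv f)
  have f: "f \<in> carrier (Isom S A)" using inv assms(1) by blast
  then have "f \<in> Bij S" by (simp add: Isom_def isometries_def)
  then have "inv\<^bsub>BijGroup S\<^esub> f = (\<lambda>x\<in>S. inv_into S f x)" by (rule inv_BijGroup)
  moreover have "inv\<^bsub>Isom S A\<^esub> f = inv\<^bsub>BijGroup S\<^esub> f"
    using group.m_inv_consistent[OF group_BijGroup subgroup_isometries] f by (simp add: Isom_def)
  moreover have "inv_into S f x = x"
    using \<open>f \<in> Bij S\<close> x inv by (metis Bij_def IntD2 bij_betw_def inv_into_f_f mem_Collect_eq)
  ultimately show ?case using x by simp
next
  case (eng g h)
  have "g \<in> carrier (Isom S A)" "h \<in> carrier (Isom S A)"
    using group.generate_in_carrier[OF group_Isom assms(1)] eng by blast+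
  then have "g \<in> Bij S" "h \<in> Bij S" by (simp_all add: Isom_def isometries_def)
  then show ?case using eng x by (simp add: Isom_def BijGroup_def compose_eq)
qed

theorem theorem6p13:
  fixes S :: "'a set" and A :: "'a set set"
    and C :: "'c set" and col :: "'a set \<Rightarrow> 'c"
    and G :: "('a \<Rightarrow> 'a) set"
  assumes "simple_graph S A"
    and "connected_graph S A"
    and "col \<in> A \<rightarrow> C"
    and "\<forall>p. elementary_cycle S A p \<longrightarrow>
           (\<forall>e\<in>path_edges p. \<forall>f\<in>path_edges p. col e = col f)"
    and "\<forall>c\<in>C. \<forall>K\<in>cells_of_color S A col c. complete_graph K (color_edges A col c)"
    and "\<forall>K\<in>cells S A C col. finite K \<and> card K \<le> 4"
    and "finitely_generated_subgroup (Isom S A) G"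
    and "GAF S G"
  shows "GAG S G"
proof -
  interpret cell_graph S A C col
  proof
    show "col e = col f" if "elementary_cycle S A p" "e \<in> path_edges p" "f \<in> path_edges p"
      for p e f using assms(4) that by blast
    show "complete_graph K (color_edges A col c)" if "c \<in> C" "K \<in> cells_of_color S A col c"
      for c K using assms(5) that by blast
  qed (fact assms(1-3))+
  obtain F where F: "finite F" "F \<subseteq> carrier (Isom S A)" "G = generate (Isom S A) F"
    and sub: "subgroup G (Isom S A)"
    using assms(7) by (auto simp: finitely_generated_subgroup_def)
  have G_Isom: "g \<in> isometries S A" if "g \<in> G" for g
    using subgroup.mem_carrier[OF sub that] by (simp add: Isom_def)
  have "\<exists>x\<in>S. \<forall>f\<in>F. f x = x"
  proof (rule common_fixed_point_finite)
    show "finite (cell y z) \<and> card (cell y z) \<le> 4" if yz: "y \<in> S" "z \<in> S" "dist y z = 1" for y z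
    proof -
      obtain K where K: "K \<in> cells S A C col" "cell y z \<subseteq> K"
        using cell_within_color_cell[OF yz] by blast
      then have "finite K" "card K \<le> 4" using assms(6) by auto
      then show ?thesis using K(2) finite_subset card_mono le_trans by metis
    qed
    show "isometry g" if "g \<in> G" for g using isometries_imp_isometry G_Isom that by blast
    show "G \<noteq> {}" using subgroup.one_closed[OF sub] by blast
    show "compose S g h \<in> G" if gh: "g \<in> G" "h \<in> G" for g h
    proof -
      have "g \<in> Bij S" "h \<in> Bij S" using G_Isom gh by (auto simp: isometries_def)
      then show ?thesis
        using subgroup.m_closed[OF sub gh] by (simp add: Isom_def BijGroup_def)
    qed
    show "\<exists>x\<in>S. g x = x" if "g \<in> G" for g
      using assms(8) that by (auto simp: GAF_def Fix_def)
    show "finite F" "F \<subseteq> G" using F generate.incl by auto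
  qed
  then obtain x where x: "x \<in> S" "\<And>f. f \<in> F \<Longrightarrow> f x = x" by blast
  then have "x \<in> (\<Inter>g\<in>G. Fix S g)"
    using generate_Isom_fixes[OF F(2)] F(3) by (auto simp: Fix_def)
  then show ?thesis unfolding GAG_def by blast
qed

end
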